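(* Let $\Delta$ be a simplicial polytopal fan in $\mathbb{R}^d$ with ray generators $\mathbf{v}_1,\ldots,\mathbf{v}_n$ and let \[ \mathcal{U}=\{U\in\mathbb{R}^{m\times d}\colon|\hat{P}^\Delta(U,\mathbf{y})|=1\text{ for all }\mathbf{y}\in\mathbb{R}^m\}. \] Then $\mathcal{U}$ has non-empty interior for $m\ge n$. Moreover, for a generic matrix $U\in\mathbb{R}^{m\times d}$ (i.e. for all $U$ outside a set of Lebesgue measure zero), $U\in\mathcal{U}$ if and only if the bipartite graph $G_U$ has a matching of size $n$.
   Context: A fan is simplicial if every cone is generated by linearly independent vectors; polytopal if it is the normal fan of a polytope. $h_P(\mathbf{u})=\max_{\mathbf{x}\in P}\langle\mathbf{x},\mathbf{u}\rangle$. The deformation cone $\mathcal{P}(\Delta)$ is the set of polytopes whose normal fan is coarsened by $\Delta$, identified via support vectors $\mathbf{h}=(h_P(\mathbf{v}_i))_i$ with a closed polyhedral cone in $\mathbb{R}^n$. For $\mathbf{u}\in\mathbb{R}^d$, with $\sigma$ the cone of $\Delta$ containing $\mathbf{u}$ in its relative interior and $\mathbf{u}=\sum_{k\in I_\sigma}\lambda_k\mathbf{v}_k$ over the generators of $\sigma$, set $[\mathbf{u}]_i=\lambda_i$ for $i\in I_\sigma$ and $0$ otherwise. For $U\in\mathbb{R}^{m\times d}$ with rows $\mathbf{u}^{(1)},\ldots,\mathbf{u}^{(m)}$ and $\mathbf{y}\in\mathbb{R}^m$, the least-squares estimator $\hat{P}^\Delta(U,\mathbf{y})\subseteq\mathbb{R}^n$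 is the set of support vectors of polytopes $P\in\mathcal{P}(\Delta)$ minimizing $\frac1m\sum_i(h_P(\mathbf{u}^{(i)})-y^{(i)})^2$. $G_U$ is the bipartite graph on vertex set $[n]\sqcup[m]$ in which $i\in[n]$ and $j\in[m]$ are adjacent iff $[\mathbf{u}^{(j)}]_i>0$. *)

theory Defs
  imports "HOL-Analysis.Analysis"
begin

text \<open>Ray generators are indexed by a finite type 'n (so n = CARD('n)); a simplicial
fan is encoded by the family of index sets of generators of its cones.\<close>

definition pos_hull :: "('n::finite \<Rightarrow> real^'d) \<Rightarrow> 'n set \<Rightarrow> (real^'d) set" where
  "pos_hull v I = {(\<Sum>i\<in>I. c i *\<^sub>R v i) | c. \<forall>i\<in>I. 0 \<le> c i}"

definition simplicial_fan :: "('n::finite \<Rightarrow> real^'d) \<Rightarrow> 'n set set \<Rightarrow> bool" where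
  "simplicial_fan v \<Delta> \<longleftrightarrow>
     {} \<in> \<Delta> \<and>
     (\<forall>I\<in>\<Delta>. \<forall>J. J \<subseteq> I \<longrightarrow> J \<in> \<Delta>) \<and>
     (\<forall>I\<in>\<Delta>. inj_on v I \<and> independent (v ` I)) \<and>
     (\<forall>I\<in>\<Delta>. \<forall>J\<in>\<Delta>. pos_hull v I \<inter> pos_hull v J = pos_hull v (I \<inter> J)) \<and>
     (\<forall>i. {i} \<in> \<Delta>)"

definition normal_cone :: "(real^'d) set \<Rightarrow> (real^'d) set \<Rightarrow> (real^'d) set" where
  "normal_cone P F = {u. \<forall>x\<in>F. \<forall>y\<in>P. inner y u \<le> inner x u}"

definition normal_fan :: "(real^'d) set \<Rightarrow> (real^'d) set set" where
  "normal_fan P = {normal_cone P F | F. F face_of P \<and> F \<noteq> {}}"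

definition polytopal_fan :: "('n::finite \<Rightarrow> real^'d) \<Rightarrow> 'n set set \<Rightarrow> bool" where
  "polytopal_fan v \<Delta> \<longleftrightarrow> (\<exists>P. polytope P \<and> pos_hull v ` \<Delta> = normal_fan P)"

definition deformation_cone :: "('n::finite \<Rightarrow> real^'d) \<Rightarrow> 'n set set \<Rightarrow> (real^'d) set set" where
  "deformation_cone v \<Delta> = {P. polytope P \<and> P \<noteq> {} \<and>
      (\<forall>C\<in>normal_fan P. C = \<Union>{pos_hull v I | I. I \<in> \<Delta> \<and> pos_hull v I \<subseteq> C})}"

definition support_fun :: "(real^'d) set \<Rightarrow> real^'d \<Rightarrow> real" where
  "support_fun P u = Sup ((\<lambda>x. inner x u) ` P)"

definition support_vector :: "('n::finite \<Rightarrow> real^'d) \<Rightarrow> (real^'d) set \<Rightarrow> real^'n" where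
  "support_vector v P = (\<chi> i. support_fun P (v i))"

definition fan_coord :: "('n::finite \<Rightarrow> real^'d) \<Rightarrow> 'n set set \<Rightarrow> real^'d \<Rightarrow> 'n \<Rightarrow> real" where
  "fan_coord v \<Delta> u = (THE lam. \<exists>I\<in>\<Delta>. u \<in> rel_interior (pos_hull v I) \<and>
       u = (\<Sum>i\<in>I. lam i *\<^sub>R v i) \<and> (\<forall>i. i \<notin> I \<longrightarrow> lam i = 0))"

definition ls_objective :: "(real^'d) set \<Rightarrow> real^'d^'m::finite \<Rightarrow> real^'m \<Rightarrow> real" where
  "ls_objective P U y = (1 / real CARD('m)) * (\<Sum>j\<in>UNIV. (support_fun P (U $ j) - y $ j)^2)"

definition ls_estimator :: "('n::finite \<Rightarrow> real^'d) \<Rightarrow> 'n set set \<Rightarrow> real^'d^'m::finite \<Rightarrow> real^'m \<Rightarrow> (real^'n) set" where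
  "ls_estimator v \<Delta> U y = support_vector v ` {P \<in> deformation_cone v \<Delta>.
      \<forall>Q\<in>deformation_cone v \<Delta>. ls_objective P U y \<le> ls_objective Q U y}"

definition GU_edges :: "('n::finite \<Rightarrow> real^'d) \<Rightarrow> 'n set set \<Rightarrow> real^'d^'m::finite \<Rightarrow> ('n \<times> 'm) set" where
  "GU_edges v \<Delta> U = {(i, j). fan_coord v \<Delta> (U $ j) i > 0}"

definition is_matching :: "('a \<times> 'b) set \<Rightarrow> ('a \<times> 'b) set \<Rightarrow> bool" where
  "is_matching E M \<longleftrightarrow> M \<subseteq> E \<and> inj_on fst M \<and> inj_on snd M"

definition has_matching_of_size :: "('a \<times> 'b) set \<Rightarrow> nat \<Rightarrow> bool" where
  "has_matching_of_size E k \<longleftrightarrow> (\<exists>M. finite M \<and> is_matching E M \<and> card M = k)"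

definition unique_ls_set :: "('n::finite \<Rightarrow> real^'d) \<Rightarrow> 'n set set \<Rightarrow> (real^'d^'m::finite) set" where
  "unique_ls_set v \<Delta> = {U. \<forall>y. card (ls_estimator v \<Delta> U y) = 1}"

end

theory Submission
  imports Defs
begin

text \<open>On the deformation cone the support function is linear on each cone of the fan, so
$h_P(u)$ is the inner product of the support vector of $P$ with the coordinate vector $[u]$. Hence the
estimator is the set of minimizers of $|Ah - y|$ over the cone of support vectors, where
$A$ has the rows $[u^{(j)}]$. That cone is closed and convex, and its interior is non-empty because the
fan is polytopal; therefore the minimizer is unique for all $y$ iff $A$ is injective, that is,
iff some $n$-by-$n$ minor of $A$ is non-zero. A non-zero minor has a non-zero term in its Leibniz
expansion, which is a matching. Conversely, once the cones containing the rows are fixed, the minor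
given by a matching is a polynomial in $U$ equal to 1 when the matched rows are the
generators, so it vanishes only on a null set.

A zero set $Z$ of a polynomial $f$ with $f(a)$ non-zero is null: each line through $a$ meets it in a finite
set, so by Fubini almost every homothetic image of $Z$ with centre $a$ is null.\<close>

subsection \<open>Zero sets and minors\<close>

lemma null_sets_zeros_polynomial_on_lines:
  fixes f :: "'a::euclidean_space \<Rightarrow> real"
  assumes cont: "continuous_on UNIV f"
    and poly: "\<And>x. \<exists>q. \<forall>t. f (a + t *\<^sub>R x) = poly q t"
    and nz: "f a \<noteq> 0"
  shows "{x. f x = 0} \<in> null_sets lborel"
proof -
  have fin: "finite {t. f (a + t *\<^sub>R x) = 0}" for x
  proof -
    obtain q where q: "\<And>t. f (a + t *\<^sub>R x) = poly q t"
      using poly by blast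
    have "q \<noteq> 0"
      using q[of 0] nz by auto
    then show ?thesis
      using q poly_roots_finite by simp
  qed
  have "continuous_on UNIV (\<lambda>z :: 'a \<times> real. f (a + snd z *\<^sub>R fst z))"
    by (intro continuous_on_compose2[OF cont] continuous_intros) auto
  then have "{z :: 'a \<times> real. f (a + snd z *\<^sub>R fst z) \<noteq> 0} \<in> sets borel"
    by (intro borel_open open_Collect_neq continuous_on_const)
  then have meas: "{z \<in> space (lborel \<Otimes>\<^sub>M lborel). f (a + snd z *\<^sub>R fst z) \<noteq> 0}
      \<in> sets ((lborel :: 'a measure) \<Otimes>\<^sub>M (lborel :: real measure))"
    unfolding lborel_prod by simp
  have "AE x in lborel. AE t in lborel. f (a + t *\<^sub>R x) \<noteq> 0"
  proof (rule AE_I2)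
    fix x :: 'a
    show "AE t in lborel. f (a + t *\<^sub>R x) \<noteq> 0"
      using finite_imp_null_set_lborel[OF fin[of x]] by (rule AE_I') auto
  qed
  then have "AE t in lborel. AE x in lborel. f (a + t *\<^sub>R x) \<noteq> 0"
    using lborel_pair.AE_commute[of "\<lambda>x t. f (a + t *\<^sub>R x) \<noteq> 0"] meas by simp
  \<comment> \<open>Excluding \<open>t = 0\<close> makes the homothety
    \<open>a + t *\<^sub>R x\<close> a bijection, so the zero set is recovered as an image of its
    null preimage.\<close>
  then have "AE t in lborel. (AE x in lborel. f (a + t *\<^sub>R x) \<noteq> 0) \<and> t \<noteq> (0::real)"
    by (intro AE_conjI AE_lborel_singleton)
  moreover have "ae_filter (lborel :: real measure) \<noteq> bot"
    by (simp add: ae_filter_eq_bot_iff)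
  ultimately obtain t :: real where t: "AE x in lborel. f (a + t *\<^sub>R x) \<noteq> 0" "t \<noteq> 0"
    using eventually_happens' by blast
  have "continuous_on UNIV (\<lambda>x. f (a + t *\<^sub>R x))"
    by (intro continuous_on_compose2[OF cont] continuous_intros) auto
  then have "{x. f (a + t *\<^sub>R x) = 0} \<in> sets lborel"
    by (simp add: borel_closed closed_Collect_eq)
  then have "{x. f (a + t *\<^sub>R x) = 0} \<in> null_sets lborel"
    using t(1) by (subst (asm) AE_iff_null) (auto simp: null_sets_def)
  then have "negligible {x. f (a + t *\<^sub>R x) = 0}"
    by (simp add: negligible_iff_null_sets null_sets_completionI)
  then have "negligible ((\<lambda>x. a + t *\<^sub>R x) ` {x. f (a + t *\<^sub>R x) = 0})"
    by (intro negligible_differentiable_image_negligible derivative_intros) auto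
  moreover have "(\<lambda>x. a + t *\<^sub>R x) ` {x. f (a + t *\<^sub>R x) = 0} = {x. f x = 0}"
  proof safe
    fix x assume "f x = 0"
    then show "x \<in> (\<lambda>x. a + t *\<^sub>R x) ` {x. f (a + t *\<^sub>R x) = 0}"
      using t(2) by (intro image_eqI[of _ _ "(1 / t) *\<^sub>R (x - a)"]) auto
  qed
  ultimately have "{x. f x = 0} \<in> null_sets lebesgue"
    by (simp add: negligible_iff_null_sets)
  moreover have "{x. f x = 0} \<in> sets lborel"
    using cont by (simp add: borel_closed closed_Collect_eq)
  ultimately show ?thesis
    by (simp add: null_sets_completion_iff)
qed

section \<open>Determinants, injectivity and perfect matchings\<close>

lemma det_affine_polynomial:
  fixes A B :: "real^'n^'n"
  shows "\<exists>q. \<forall>t. det (A + t *\<^sub>R B) = poly q t"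
proof -
  \<comment> \<open>The Leibniz expansion carried out over polynomials in \<open>t\<close>.\<close>
  define q where "q = (\<Sum>p | p permutes UNIV. smult (of_int (sign p))
    (\<Prod>i\<in>UNIV. [:A $ i $ p i, B $ i $ p i:]))"
  have "det (A + t *\<^sub>R B) = poly q t" for t
    by (simp add: det_def q_def poly_sum poly_prod)
  then show ?thesis
    by blast
qed

lemma continuous_on_det_real:
  fixes M :: "'a::topological_space \<Rightarrow> real^'n^'n"
  assumes "\<And>i j. continuous_on S (\<lambda>x. M x $ i $ j)"
  shows "continuous_on S (\<lambda>x. det (M x))"
  unfolding det_def by (intro continuous_intros assms)

lemma det_nonzero_transversal:
  fixes A :: "real^'n^'n"
  assumes "det A \<noteq> 0"
  obtains p where "p permutes UNIV" "\<And>i. A $ i $ p i \<noteq> 0"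
proof -
  obtain p where "p permutes UNIV" "of_int (sign p) * (\<Prod>i\<in>UNIV. A $ i $ p i) \<noteq> 0"
    using assms unfolding det_def by (elim sum.not_neutral_contains_not_neutral) simp
  then show thesis
    by (intro that[of p]) auto
qed

text \<open>Injectivity means that the rows span, so a basis can be chosen among them and
  \<open>f\<close> lists row indices of its members. Conversely, a vector killed by \<open>A\<close>
  is killed by every selection of its rows.\<close>

lemma inj_matrix_iff_minor:
  fixes A :: "real^'n^'m"
  shows "inj ((*v) A) \<longleftrightarrow> (\<exists>f :: 'n \<Rightarrow> 'm. det (\<chi> i. A $ f i) \<noteq> 0)"
proof
  assume "inj ((*v) A)"
  then have span: "span (rows A) = UNIV"
    using matrix_left_invertible_injective matrix_left_invertible_span_rows by blast
  obtain B where B: "B \<subseteq> rows A" "independent B" "rows A \<subseteq> span B"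
    using basis_exists[of "rows A"] by metis
  have spanB: "span B = UNIV"
    using span_minimal[OF B(3) subspace_span] span by auto
  then have "card B = CARD('n)"
    using dim_span_eq_card_independent[OF B(2)] by simp
  then obtain g :: "'n \<Rightarrow> real^'n" where g: "bij_betw g UNIV B"
    using finite_same_card_bij[of "UNIV :: 'n set" B] independent_imp_finite[OF B(2)] by auto
  have "\<exists>j. g i = A $ j" for i
  proof -
    have "g i \<in> rows A"
      using g B(1) by (auto simp: bij_betw_def)
    then show ?thesis
      by (auto simp: rows_def row_def)
  qed
  then obtain f where f: "\<And>i. g i = A $ f i"
    by metis
  have "rows (\<chi> i. A $ f i) = B"
    using g by (auto simp: rows_def row_def bij_betw_def simp flip: f)
  then have "invertible (\<chi> i. A $ f i)"
    using spanB by (simp add: invertible_left_inverse matrix_left_invertible_span_rows)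
  then show "\<exists>f :: 'n \<Rightarrow> 'm. det (\<chi> i. A $ f i) \<noteq> 0"
    using invertible_det_nz by blast
next
  assume "\<exists>f :: 'n \<Rightarrow> 'm. det (\<chi> i. A $ f i) \<noteq> 0"
  then obtain f :: "'n \<Rightarrow> 'm" where "det (\<chi> i. A $ f i) \<noteq> 0" ..
  then have "inj ((*v) (\<chi> i. A $ f i))"
    by (metis invertible_det_nz invertible_left_inverse matrix_left_invertible_injective)
  moreover have "(\<chi> i. A $ f i) *v x = (\<chi> i. (A *v x) $ f i)" for x
    by (simp add: matrix_vector_mult_def)
  ultimately show "inj ((*v) A)"
    by (auto simp: inj_def)
qed

text \<open>The edges of a matching have distinct first endpoints, so as many edges as elements of
  \<open>'n\<close> cover all of \<open>'n\<close> and form the graph of an injection.\<close>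

lemma perfect_matching_iff:
  fixes E :: "('n::finite \<times> 'm) set"
  shows "has_matching_of_size E CARD('n) \<longleftrightarrow> (\<exists>f. inj f \<and> (\<forall>i. (i, f i) \<in> E))"
proof
  assume "has_matching_of_size E CARD('n)"
  then obtain M where M: "finite M" "M \<subseteq> E" "inj_on fst M" "inj_on snd M" "card M = CARD('n)"
    unfolding has_matching_of_size_def is_matching_def by blast
  then have "card (fst ` M) = CARD('n)"
    by (simp add: card_image)
  then have "fst ` M = UNIV"
    by (metis card_subset_eq finite subset_UNIV)
  then have "\<exists>j. (i, j) \<in> M" for i
    by (metis UNIV_I imageE prod.collapse)
  then obtain f where f: "\<And>i. (i, f i) \<in> M"
    by metis
  have "inj f"
    using f inj_onD[OF M(4)] by (metis injI prod.inject snd_conv)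
  then show "\<exists>f. inj f \<and> (\<forall>i. (i, f i) \<in> E)"
    using f M(2) by blast
next
  assume "\<exists>f. inj f \<and> (\<forall>i. (i, f i) \<in> E)"
  then obtain f where f: "inj f" "\<And>i. (i, f i) \<in> E"
    by blast
  show "has_matching_of_size E CARD('n)"
    unfolding has_matching_of_size_def is_matching_def
  proof (intro exI conjI)
    show "card (range (\<lambda>i. (i, f i))) = CARD('n)"
      by (intro card_image inj_onI) simp
  qed (use f in \<open>auto simp: inj_on_def\<close>)
qed

subsection \<open>Cones and support functions\<close>

lemma pos_hullI: "(\<And>i. i \<in> I \<Longrightarrow> 0 \<le> c i) \<Longrightarrow> (\<Sum>i\<in>I. c i *\<^sub>R v i) \<in> pos_hull v I"
  unfolding pos_hull_def by blast

lemma pos_hullE: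
  assumes "u \<in> pos_hull v I"
  obtains c where "u = (\<Sum>i\<in>I. c i *\<^sub>R v i)" "\<And>i. i \<in> I \<Longrightarrow> 0 \<le> c i"
  using assms unfolding pos_hull_def by blast

lemma sum_in_pos_hull:
  assumes "K \<subseteq> I" "\<And>i. i \<in> K \<Longrightarrow> 0 \<le> c i"
  shows "(\<Sum>i\<in>K. c i *\<^sub>R v i) \<in> pos_hull v I"
proof -
  have "(\<Sum>i\<in>K. c i *\<^sub>R v i) = (\<Sum>i\<in>I. (if i \<in> K then c i else 0) *\<^sub>R v i)"
    by (rule sum.mono_neutral_cong_left) (use assms(1) in auto)
  also have "\<dots> \<in> pos_hull v I"
    using assms(2) by (intro pos_hullI) auto
  finally show ?thesis .
qed

lemma generator_in_pos_hull: "i \<in> I \<Longrightarrow> v i \<in> pos_hull v I"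
  using sum_in_pos_hull[of "{i}" I "\<lambda>_. 1" v] by simp

lemma convex_pos_hull: "convex (pos_hull v I)"
proof (rule convexI)
  fix x y and a b :: real
  assume "x \<in> pos_hull v I" "y \<in> pos_hull v I" and ab: "0 \<le> a" "0 \<le> b"
  then obtain c d where x: "x = (\<Sum>i\<in>I. c i *\<^sub>R v i)" "\<And>i. i \<in> I \<Longrightarrow> 0 \<le> c i"
    and y: "y = (\<Sum>i\<in>I. d i *\<^sub>R v i)" "\<And>i. i \<in> I \<Longrightarrow> 0 \<le> d i"
    by (elim pos_hullE) metis
  have "a *\<^sub>R x + b *\<^sub>R y = (\<Sum>i\<in>I. (a * c i + b * d i) *\<^sub>R v i)"
    by (simp add: x y scaleR_sum_right sum.distrib scaleR_add_left)
  then show "a *\<^sub>R x + b *\<^sub>R y \<in> pos_hull v I"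
    using x(2) y(2) ab by (simp add: pos_hullI)
qed

section \<open>Support functions and exposed faces of polytopes\<close>

lemma support_fun_eqI:
  assumes "x \<in> P" "\<And>y. y \<in> P \<Longrightarrow> y \<bullet> u \<le> x \<bullet> u"
  shows "support_fun P u = x \<bullet> u"
  unfolding support_fun_def using assms by (intro cSup_eq_maximum) auto

lemma support_fun_attained:
  assumes "polytope P" "P \<noteq> {}"
  obtains x where "x \<in> P" "support_fun P u = x \<bullet> u"
proof -
  have "continuous_on P (\<lambda>x. x \<bullet> u)"
    by (intro continuous_intros)
  then obtain x where x: "x \<in> P" "\<And>y. y \<in> P \<Longrightarrow> y \<bullet> u \<le> x \<bullet> u"
    using continuous_attains_sup[of P "\<lambda>x. x \<bullet> u"] polytope_imp_compact[OF assms(1)] assms(2) by blast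
  then show thesis
    using that support_fun_eqI by blast
qed

lemma support_fun_upper:
  assumes "polytope P" "x \<in> P"
  shows "x \<bullet> u \<le> support_fun P u"
proof -
  have "bounded ((\<lambda>x. x \<bullet> u) ` P)"
    using polytope_imp_bounded[OF assms(1)] bounded_linear_image bounded_linear_inner_left by blast
  then show ?thesis
    unfolding support_fun_def by (intro cSup_upper bounded_imp_bdd_above imageI assms(2))
qed

definition exposed_face :: "(real^'d) set \<Rightarrow> real^'d \<Rightarrow> (real^'d) set" where
  "exposed_face P u = {x \<in> P. x \<bullet> u = support_fun P u}"

text \<open>Used mainly to place a direction \<open>u\<close> in a cone of the normal fan: by the
  third claim with \<open>w = u\<close>, it lies in the normal cone of the face that it
  exposes.\<close>

lemma exposed_face:
  assumes "polytope P" "P \<noteq> {}"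
  shows "exposed_face P u face_of P" "exposed_face P u \<noteq> {}"
    and "w \<in> normal_cone P (exposed_face P u) \<longleftrightarrow>
           (\<forall>x\<in>exposed_face P u. x \<bullet> w = support_fun P w)"
    and "normal_cone P (exposed_face P u) \<in> normal_fan P"
proof -
  have "exposed_face P u = P \<inter> {x. u \<bullet> x = support_fun P u}"
    by (auto simp: exposed_face_def inner_commute)
  moreover have "P \<inter> {x. u \<bullet> x = support_fun P u} face_of P"
    using support_fun_upper[OF assms(1)] polytope_imp_convex[OF assms(1)]
    by (intro face_of_Int_supporting_hyperplane_le) (auto simp: inner_commute)
  ultimately show face: "exposed_face P u face_of P"
    by simp
  show nonempty: "exposed_face P u \<noteq> {}"
    by (rule support_fun_attained[OF assms, of u]) (auto simp: exposed_face_def)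
  show "w \<in> normal_cone P (exposed_face P u) \<longleftrightarrow>
           (\<forall>x\<in>exposed_face P u. x \<bullet> w = support_fun P w)"
  proof
    assume "w \<in> normal_cone P (exposed_face P u)"
    then show "\<forall>x\<in>exposed_face P u. x \<bullet> w = support_fun P w"
      using support_fun_eqI[of _ P w] by (force simp: normal_cone_def exposed_face_def)
  next
    assume "\<forall>x\<in>exposed_face P u. x \<bullet> w = support_fun P w"
    then show "w \<in> normal_cone P (exposed_face P u)"
      using support_fun_upper[OF assms(1)] by (auto simp: normal_cone_def)
  qed
  show "normal_cone P (exposed_face P u) \<in> normal_fan P"
    unfolding normal_fan_def using face nonempty by blast
qed

section \<open>Linear coordinates on the cones of the fan\<close>

locale simplicial_polytopal_fan =
  fixes v :: "'n::finite \<Rightarrow> real^'d" and \<Delta> :: "'n set set"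
  assumes simplicial: "simplicial_fan v \<Delta>" and polytopal: "polytopal_fan v \<Delta>"
begin

lemma cone_empty: "{} \<in> \<Delta>"
  and cone_subset: "I \<in> \<Delta> \<Longrightarrow> J \<subseteq> I \<Longrightarrow> J \<in> \<Delta>"
  and cone_inj: "I \<in> \<Delta> \<Longrightarrow> inj_on v I"
  and cone_independent: "I \<in> \<Delta> \<Longrightarrow> independent (v ` I)"
  and cone_Int: "I \<in> \<Delta> \<Longrightarrow> J \<in> \<Delta> \<Longrightarrow> pos_hull v I \<inter> pos_hull v J = pos_hull v (I \<inter> J)"
  and cone_ray: "{i} \<in> \<Delta>"
  using simplicial unfolding simplicial_fan_def by blast+

text \<open>Outside the span of the generators of \<open>I\<close> the values of this linear map are arbitrary.\<close>

definition coord :: "'n set \<Rightarrow> real^'d \<Rightarrow> real^'n" where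
  "coord I = (SOME L. linear L \<and> (\<forall>i\<in>I. L (v i) = axis i 1))"

lemma coord:
  assumes "I \<in> \<Delta>"
  shows "linear (coord I)" "i \<in> I \<Longrightarrow> coord I (v i) = axis i 1"
proof -
  obtain L :: "real^'d \<Rightarrow> real^'n"
    where "linear L" "\<forall>x\<in>v ` I. L x = axis (inv_into I v x) 1"
    using linear_independent_extend[OF cone_independent[OF assms], of "\<lambda>x. axis (inv_into I v x) 1"]
    by blast
  then have "\<exists>L. linear L \<and> (\<forall>i\<in>I. L (v i) = axis i (1::real))"
    using cone_inj[OF assms] by auto
  then have "linear (coord I) \<and> (\<forall>i\<in>I. coord I (v i) = axis i 1)"
    unfolding coord_def by (rule someI_ex)
  then show "linear (coord I)" "i \<in> I \<Longrightarrow> coord I (v i) = axis i 1"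
    by blast+
qed

lemma coord_sum:
  assumes "I \<in> \<Delta>" "K \<subseteq> I"
  shows "coord I (\<Sum>i\<in>K. c i *\<^sub>R v i) = (\<chi> i. if i \<in> K then c i else 0)"
proof -
  have "coord I (\<Sum>i\<in>K. c i *\<^sub>R v i) = (\<Sum>i\<in>K. c i *\<^sub>R axis i 1)"
    using assms by (auto simp: linear_sum[OF coord(1)] linear_scale[OF coord(1)] coord(2) intro!: sum.cong)
  also have "\<dots> = (\<chi> i. if i \<in> K then c i else 0)"
  proof (rule vec_eq_iff[THEN iffD2], rule allI)
    fix j
    have "(\<Sum>i\<in>K. c i *\<^sub>R axis i 1) $ j = (\<Sum>i\<in>K. if j = i then c i else 0)"
      unfolding sum_component by (intro sum.cong) (auto simp: axis_def)
    also have "\<dots> = (\<chi> i. if i \<in> K then c i else 0) $ j"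
      by simp
    finally show "(\<Sum>i\<in>K. c i *\<^sub>R axis i 1) $ j = (\<chi> i. if i \<in> K then c i else 0) $ j" .
  qed
  finally show ?thesis .
qed

lemma pos_hull_iff:
  assumes "I \<in> \<Delta>"
  shows "u \<in> pos_hull v I \<longleftrightarrow>
    (\<forall>i\<in>I. 0 \<le> coord I u $ i) \<and> u = (\<Sum>i\<in>I. coord I u $ i *\<^sub>R v i)"
proof
  assume "u \<in> pos_hull v I"
  then obtain c where "u = (\<Sum>i\<in>I. c i *\<^sub>R v i)" "\<And>i. i \<in> I \<Longrightarrow> 0 \<le> c i"
    by (elim pos_hullE) blast
  then show "(\<forall>i\<in>I. 0 \<le> coord I u $ i) \<and> u = (\<Sum>i\<in>I. coord I u $ i *\<^sub>R v i)"
    using coord_sum[OF assms order_refl] by simp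
next
  assume "(\<forall>i\<in>I. 0 \<le> coord I u $ i) \<and> u = (\<Sum>i\<in>I. coord I u $ i *\<^sub>R v i)"
  then show "u \<in> pos_hull v I"
    by (metis pos_hullI)
qed

lemma coord_outside: "I \<in> \<Delta> \<Longrightarrow> u \<in> pos_hull v I \<Longrightarrow> i \<notin> I \<Longrightarrow> coord I u $ i = 0"
  using coord_sum[OF _ order_refl] by (elim pos_hullE) simp

text \<open>By the intersection axiom \<open>u\<close> is a combination of the common generators, on
  which both linear maps agree. This makes the coordinates of \<open>u\<close> independent of the
  cone.\<close>

lemma coord_eq:
  assumes "I \<in> \<Delta>" "J \<in> \<Delta>" "u \<in> pos_hull v I" "u \<in> pos_hull v J"
  shows "coord I u = coord J u"
proof -
  have "u \<in> pos_hull v (I \<inter> J)"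
    using assms cone_Int by blast
  then obtain c where "u = (\<Sum>i\<in>I \<inter> J. c i *\<^sub>R v i)"
    by (elim pos_hullE) blast
  then show ?thesis
    using coord_sum[of I "I \<inter> J" c] coord_sum[of J "I \<inter> J" c] assms(1,2) by simp
qed

lemma continuous_on_coord: "I \<in> \<Delta> \<Longrightarrow> continuous_on S (coord I)"
  by (rule linear_continuous_on[OF linear_conv_bounded_linear[THEN iffD1, OF coord(1)]])

lemma closed_pos_hull: "I \<in> \<Delta> \<Longrightarrow> closed (pos_hull v I)"
proof -
  assume I: "I \<in> \<Delta>"
  have "closed ((\<Inter>i\<in>I. {u. 0 \<le> coord I u $ i}) \<inter> {u. u = (\<Sum>i\<in>I. coord I u $ i *\<^sub>R v i)})"
    by (intro closed_Int closed_INT ballI closed_Collect_le closed_Collect_eq continuous_intros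
        continuous_on_coord I)
  moreover have "pos_hull v I =
      (\<Inter>i\<in>I. {u. 0 \<le> coord I u $ i}) \<inter> {u. u = (\<Sum>i\<in>I. coord I u $ i *\<^sub>R v i)}"
    using pos_hull_iff[OF I] by blast
  ultimately show ?thesis
    by simp
qed

lemma fan_complete: "\<exists>I\<in>\<Delta>. u \<in> pos_hull v I"
proof -
  obtain P where P: "polytope P" "pos_hull v ` \<Delta> = normal_fan P"
    using polytopal unfolding polytopal_fan_def by blast
  \<comment> \<open>The fan has at least the cone of \<open>{}\<close>, whereas the empty polytope
    has no non-empty face and hence an empty normal fan.\<close>
  then have "P \<noteq> {}"
    using cone_empty by (auto simp: normal_fan_def)
  note face = exposed_face[OF P(1) this, where u = u]
  have "u \<in> normal_cone P (exposed_face P u)"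
    using face(3) by (simp add: exposed_face_def)
  then show ?thesis
    using face(4) P(2) by (metis imageE)
qed

text \<open>A point is relatively interior iff every segment ending there from a point of the cone
  can be prolonged. Prolonging from the generator \<open>v k\<close> when \<open>c k = 0\<close>
  would make the \<open>k\<close>-th coordinate \<open>1 - e < 0\<close>.\<close>

lemma rel_interior_pos_hull:
  assumes K: "K \<in> \<Delta>"
  shows "(\<Sum>i\<in>K. c i *\<^sub>R v i) \<in> rel_interior (pos_hull v K) \<longleftrightarrow> (\<forall>i\<in>K. 0 < c i)"
    (is "?u \<in> _ \<longleftrightarrow> _")
proof -
  have nonempty: "pos_hull v K \<noteq> {}"
    using sum_in_pos_hull[of "{}" K] by auto
  note iff = convex_rel_interior_iff[OF convex_pos_hull nonempty, of ?u]
  show ?thesis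
  proof
    assume u: "?u \<in> rel_interior (pos_hull v K)"
    then have c: "0 \<le> c i" if "i \<in> K" for i
      using rel_interior_subset pos_hull_iff[OF K, of ?u] coord_sum[OF K order_refl, of c] that by auto
    show "\<forall>i\<in>K. 0 < c i"
    proof
      fix k assume k: "k \<in> K"
      then obtain e where e: "e > 1" "(1 - e) *\<^sub>R v k + e *\<^sub>R ?u \<in> pos_hull v K"
        using u iff generator_in_pos_hull by blast
      have "coord K ((1 - e) *\<^sub>R v k + e *\<^sub>R ?u) $ k = (1 - e) + e * c k"
        using k by (simp add: linear_add[OF coord(1)[OF K]] linear_scale[OF coord(1)[OF K]]
            coord(2)[OF K k] coord_sum[OF K order_refl] axis_def)
      then have "0 \<le> (1 - e) + e * c k"
        using e(2) k pos_hull_iff[OF K] by auto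
      then show "0 < c k"
        using e(1) c[OF k] by (cases "c k = 0") auto
    qed
  next
    assume c: "\<forall>i\<in>K. 0 < c i"
    have "\<exists>e>1. (1 - e) *\<^sub>R x + e *\<^sub>R ?u \<in> pos_hull v K" if "x \<in> pos_hull v K" for x
    proof -
      obtain d where d: "x = (\<Sum>i\<in>K. d i *\<^sub>R v i)" "\<And>i. i \<in> K \<Longrightarrow> 0 \<le> d i"
        using \<open>x \<in> pos_hull v K\<close> by (elim pos_hullE) blast
      \<comment> \<open>The sum bounds every ratio \<open>d i / c i\<close>. With
        \<open>e - 1 = 1 / (1 + s)\<close> the amount \<open>(e - 1) * d i\<close> that is
        subtracted is at most \<open>c i\<close>.\<close>
      define s where "s = (\<Sum>i\<in>K. d i / c i)"
      have s: "d i \<le> s * c i" if "i \<in> K" for i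
      proof -
        have "d i / c i \<le> s"
          unfolding s_def using that c d(2) by (intro member_le_sum) (auto intro: less_imp_le)
        then show ?thesis
          using c that by (simp add: pos_divide_le_eq)
      qed
      have s0: "0 \<le> s"
        unfolding s_def using c d(2) by (intro sum_nonneg) (auto intro: less_imp_le)
      define e where "e = 1 + 1 / (1 + s)"
      have e: "e > 1"
        using s0 by (simp add: e_def)
      have "0 \<le> (1 - e) * d i + e * c i" if "i \<in> K" for i
      proof -
        have "d i / (1 + s) \<le> c i"
          using s[OF that] s0 c that by (simp add: pos_divide_le_eq algebra_simps less_imp_le add_increasing)
        moreover have "c i \<le> e * c i"
          using c that e by (simp add: less_imp_le)
        ultimately show ?thesis
          by (simp add: e_def)
      qed
      then have "(\<Sum>i\<in>K. ((1 - e) * d i + e * c i) *\<^sub>R v i) \<in> pos_hull v K"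
        by (rule pos_hullI)
      then have "(1 - e) *\<^sub>R x + e *\<^sub>R ?u \<in> pos_hull v K"
        by (simp add: d(1) scaleR_sum_right sum.distrib scaleR_add_left)
      then show ?thesis
        using e by blast
    qed
    then show "?u \<in> rel_interior (pos_hull v K)"
      using iff by blast
  qed
qed

text \<open>Passes from any cone containing \<open>u\<close> to the face of it that has
  \<open>u\<close> in its relative interior.\<close>

lemma coord_support:
  assumes I: "I \<in> \<Delta>" and u: "u \<in> pos_hull v I"
  defines "K \<equiv> {i. 0 < coord I u $ i}"
  shows "K \<in> \<Delta>" "K \<subseteq> I" "u = (\<Sum>i\<in>K. coord I u $ i *\<^sub>R v i)" "i \<notin> K \<Longrightarrow> coord I u $ i = 0"
proof -
  show KI: "K \<subseteq> I"
    using coord_outside[OF I u] by (force simp: K_def)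
  then show "K \<in> \<Delta>"
    using cone_subset[OF I] by blast
  have nonneg: "0 \<le> coord I u $ i" for i
    using pos_hull_iff[OF I, of u] coord_outside[OF I u] u by (cases "i \<in> I") auto
  then show zero: "i \<notin> K \<Longrightarrow> coord I u $ i = 0" for i
    by (force simp: K_def not_less intro: antisym)
  have "u = (\<Sum>i\<in>I. coord I u $ i *\<^sub>R v i)"
    using pos_hull_iff[OF I, of u] u by blast
  also have "\<dots> = (\<Sum>i\<in>K. coord I u $ i *\<^sub>R v i)"
    by (rule sum.mono_neutral_right) (use KI zero in auto)
  finally show "u = (\<Sum>i\<in>K. coord I u $ i *\<^sub>R v i)" .
qed

text \<open>Frees \<open>fan_coord\<close> from the relative interior: any cone containing
  \<open>u\<close> may be used. Existence comes from the face in \<open>coord_support\<close>,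
  uniqueness from \<open>coord_eq\<close>.\<close>

lemma fan_coord_eq:
  assumes I: "I \<in> \<Delta>" and u: "u \<in> pos_hull v I"
  shows "fan_coord v \<Delta> u = ($) (coord I u)"
  unfolding fan_coord_def
proof (rule the_equality)
  define K where "K = {i. 0 < coord I u $ i}"
  note K = coord_support[OF I u, folded K_def]
  have "(\<Sum>i\<in>K. coord I u $ i *\<^sub>R v i) \<in> rel_interior (pos_hull v K)"
    using rel_interior_pos_hull[OF K(1)] by (simp add: K_def)
  then show "\<exists>K\<in>\<Delta>. u \<in> rel_interior (pos_hull v K) \<and>
      u = (\<Sum>i\<in>K. coord I u $ i *\<^sub>R v i) \<and> (\<forall>i. i \<notin> K \<longrightarrow> coord I u $ i = 0)"
    using K by (intro bexI[of _ K]) auto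
next
  fix lam
  assume "\<exists>J\<in>\<Delta>. u \<in> rel_interior (pos_hull v J) \<and>
      u = (\<Sum>i\<in>J. lam i *\<^sub>R v i) \<and> (\<forall>i. i \<notin> J \<longrightarrow> lam i = 0)"
  then obtain J where J: "J \<in> \<Delta>" "u \<in> pos_hull v J" "u = (\<Sum>i\<in>J. lam i *\<^sub>R v i)"
    "\<And>i. i \<notin> J \<Longrightarrow> lam i = 0"
    using rel_interior_subset by blast
  have "coord J u = (\<chi> i. if i \<in> J then lam i else 0)"
    using coord_sum[OF J(1) order_refl, of lam] J(3) by simp
  then show "lam = ($) (coord I u)"
    using coord_eq[OF I J(1) u J(2)] J(4) by (auto simp: fun_eq_iff)
qed

definition fcoord :: "real^'d \<Rightarrow> real^'n" where
  "fcoord u = (\<chi> i. fan_coord v \<Delta> u i)"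

lemma fcoord_eq: "I \<in> \<Delta> \<Longrightarrow> u \<in> pos_hull v I \<Longrightarrow> fcoord u = coord I u"
  by (simp add: fcoord_def fan_coord_eq vec_eq_iff)

lemma fan_coord_nonneg: "0 \<le> fan_coord v \<Delta> u i"
proof -
  obtain I where I: "I \<in> \<Delta>" "u \<in> pos_hull v I"
    using fan_complete by blast
  then show ?thesis
    using fan_coord_eq[OF I] coord_outside[OF I] pos_hull_iff[OF I(1), of u] by (cases "i \<in> I") auto
qed

lemma fcoord_generator: "fcoord (v i) = axis i 1"
  using fcoord_eq[OF cone_ray, of "v i" i] generator_in_pos_hull[of i "{i}" v] coord(2)[OF cone_ray]
  by simp

text \<open>Pasting: finitely many closed cones cover the space, and \<open>fcoord\<close> is linear
  on each.\<close>

lemma continuous_on_fcoord: "continuous_on UNIV fcoord"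
proof -
  have "continuous_on (\<Union>I\<in>\<Delta>. pos_hull v I) fcoord"
  proof (rule continuous_on_closed_Union)
    fix I assume I: "I \<in> \<Delta>"
    show "continuous_on (pos_hull v I) fcoord"
      using continuous_on_coord[OF I] fcoord_eq[OF I] by (subst continuous_on_cong) auto
  qed (use closed_pos_hull in auto)
  moreover have "(\<Union>I\<in>\<Delta>. pos_hull v I) = UNIV"
    using fan_complete by auto
  ultimately show ?thesis
    by simp
qed

subsection \<open>The cone of support vectors\<close>

lemma inner_coord_sum:
  assumes "I \<in> \<Delta>" "u \<in> pos_hull v I"
  shows "h \<bullet> fcoord u = (\<Sum>i\<in>I. coord I u $ i * h $ i)"
proof -
  have "h \<bullet> fcoord u = (\<Sum>i\<in>UNIV. coord I u $ i * h $ i)"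
    by (simp add: fcoord_eq[OF assms] inner_vec_def mult.commute)
  also have "\<dots> = (\<Sum>i\<in>I. coord I u $ i * h $ i)"
    by (rule sum.mono_neutral_right) (use coord_outside[OF assms] in auto)
  finally show ?thesis .
qed

lemma inner_pos_hull_sum:
  assumes "I \<in> \<Delta>" "u \<in> pos_hull v I"
  shows "x \<bullet> u = (\<Sum>i\<in>I. coord I u $ i * (x \<bullet> v i))"
proof -
  have "u = (\<Sum>i\<in>I. coord I u $ i *\<^sub>R v i)"
    using assms pos_hull_iff by blast
  then have "x \<bullet> u = x \<bullet> (\<Sum>i\<in>I. coord I u $ i *\<^sub>R v i)"
    by (rule arg_cong)
  then show ?thesis
    by (simp add: inner_sum_right)
qed

text \<open>Coarsening puts a cone of the fan around \<open>u\<close> inside the normal cone of the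
  face exposed by \<open>u\<close>. A single point \<open>x\<close> of that face then attains the
  support function at \<open>u\<close> and at all generators of this cone, so the value at
  \<open>u\<close> is the linear combination of theirs.\<close>

lemma support_fun_deformation:
  assumes Q: "Q \<in> deformation_cone v \<Delta>"
  shows "support_fun Q u = support_vector v Q \<bullet> fcoord u"
proof -
  have poly: "polytope Q" "Q \<noteq> {}"
    using Q by (auto simp: deformation_cone_def)
  note face = exposed_face[OF poly, where u = u]
  define C where "C = normal_cone Q (exposed_face Q u)"
  have "u \<in> C"
    unfolding C_def using face(3) by (simp add: exposed_face_def)
  moreover have "C = \<Union>{pos_hull v I | I. I \<in> \<Delta> \<and> pos_hull v I \<subseteq> C}"
    using Q face(4) unfolding deformation_cone_def C_def by blast
  ultimately obtain J where J: "J \<in> \<Delta>" "u \<in> pos_hull v J" "pos_hull v J \<subseteq> C"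
    by auto
  obtain x where x: "x \<in> exposed_face Q u"
    using face(2) by blast
  have gen: "x \<bullet> v i = support_vector v Q $ i" if "i \<in> J" for i
  proof -
    have "v i \<in> C"
      using J(3) generator_in_pos_hull[OF that] by blast
    then show ?thesis
      using face(3) x by (simp add: C_def support_vector_def)
  qed
  have "support_fun Q u = x \<bullet> u"
    using x by (simp add: exposed_face_def)
  also have "\<dots> = (\<Sum>i\<in>J. coord J u $ i * support_vector v Q $ i)"
    unfolding inner_pos_hull_sum[OF J(1,2)] by (intro sum.cong) (auto simp: gen)
  also have "\<dots> = support_vector v Q \<bullet> fcoord u"
    by (rule inner_coord_sum[OF J(1,2), symmetric])
  finally show ?thesis .
qed

section \<open>Full-dimensional cones and the vertices they determine\<close>

definition full_cones :: "'n set set" where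
  "full_cones = {I \<in> \<Delta>. card I = CARD('d)}"

lemma full_conesD: "I \<in> full_cones \<Longrightarrow> I \<in> \<Delta>"
  by (simp add: full_cones_def)

lemma dim_cone: "I \<in> \<Delta> \<Longrightarrow> dim (v ` I) = card I"
  using dim_eq_card_independent[OF cone_independent] card_image[OF cone_inj] by metis

text \<open>The generators of a full-dimensional cone form a basis, so here \<open>coord I\<close>
  is determined on the whole space.\<close>

lemma coord_full:
  assumes I: "I \<in> full_cones"
  shows "u = (\<Sum>i\<in>I. coord I u $ i *\<^sub>R v i)" "i \<notin> I \<Longrightarrow> coord I u $ i = 0"
proof -
  note I' = full_conesD[OF I]
  have "dim (v ` I) = DIM(real^'d)"
    using dim_cone[OF I'] I by (simp add: full_cones_def)
  then have "u \<in> span (v ` I)"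
    using dim_eq_full by blast
  then obtain c where "u = (\<Sum>x\<in>v ` I. c x *\<^sub>R x)"
    by (auto simp: span_finite)
  then have c: "u = (\<Sum>i\<in>I. c (v i) *\<^sub>R v i)"
    by (simp add: sum.reindex[OF cone_inj[OF I']])
  have "coord I u = (\<chi> i. if i \<in> I then c (v i) else 0)"
    unfolding c by (rule coord_sum[OF I' order_refl])
  then show "u = (\<Sum>i\<in>I. coord I u $ i *\<^sub>R v i)" "i \<notin> I \<Longrightarrow> coord I u $ i = 0"
    using c by simp_all
qed

text \<open>The lower-dimensional cones are negligible, so the closed union of the full-dimensional
ones has empty complement.\<close>

lemma full_cones_cover: "\<exists>I\<in>full_cones. u \<in> pos_hull v I"
proof -
  define T where "T = (\<Union>I\<in>full_cones. pos_hull v I)"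
  have "closed T"
    unfolding T_def using closed_pos_hull full_conesD by (intro closed_UN) auto
  have small: "negligible (pos_hull v I)" if I: "I \<in> \<Delta> - full_cones" for I
  proof -
    have "card I \<noteq> DIM(real^'d)"
      using I by (auto simp: full_cones_def)
    then have "dim (v ` I) < DIM(real^'d)"
      using dim_cone[of I] dim_subset_UNIV[of "v ` I"] I by auto
    then have "negligible (span (v ` I))"
      by (intro negligible_lowdim) simp
    moreover have "pos_hull v I \<subseteq> span (v ` I)"
      by (auto simp: pos_hull_def intro!: span_sum span_scale intro: span_base)
    ultimately show ?thesis
      by (rule negligible_subset)
  qed
  have "negligible (\<Union>I\<in>\<Delta> - full_cones. pos_hull v I)"
    using small by (intro negligible_Union) auto
  moreover have "- T \<subseteq> (\<Union>I\<in>\<Delta> - full_cones. pos_hull v I)"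
    using fan_complete by (fastforce simp: T_def)
  ultimately have "negligible (- T)"
    by (rule negligible_subset)
  then have "- T = {}"
    using \<open>closed T\<close> open_not_negligible by blast
  then show ?thesis
    unfolding T_def by blast
qed

text \<open>If \<open>h\<close> is the support vector of a polytope in the deformation cone, this is the vertex
of that polytope corresponding to the full-dimensional cone spanned by \<open>I\<close>.\<close>

definition cone_vertex :: "real^'n \<Rightarrow> 'n set \<Rightarrow> real^'d" where
  "cone_vertex h I = adjoint (coord I) h"

lemma inner_cone_vertex:
  "I \<in> \<Delta> \<Longrightarrow> cone_vertex h I \<bullet> u = h \<bullet> coord I u"
  using adjoint_works[OF coord(1), of I u h] by (simp add: cone_vertex_def inner_commute)

lemma cone_vertex_eqI:
  assumes I: "I \<in> full_cones" and x: "\<And>i. i \<in> I \<Longrightarrow> x \<bullet> v i = h $ i"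
  shows "x = cone_vertex h I"
proof -
  have "x \<bullet> u = cone_vertex h I \<bullet> u" for u
  proof -
    have "x \<bullet> u = (\<Sum>i\<in>I. coord I u $ i * (x \<bullet> v i))"
      by (subst coord_full(1)[OF I, of u]) (simp add: inner_sum_right)
    also have "\<dots> = (\<Sum>i\<in>I. coord I u $ i * h $ i)"
      using x by simp
    also have "\<dots> = h \<bullet> coord I u"
      unfolding inner_vec_def
      by (rule sum.mono_neutral_cong_left) (use coord_full(2)[OF I] in \<open>auto simp: mult.commute\<close>)
    finally show ?thesis
      using inner_cone_vertex[OF full_conesD[OF I]] by simp
  qed
  then show ?thesis
    by (metis vector_eq_rdot)
qed

text \<open>The direction has all coordinates 1 on \<open>I\<close>. A maximizer \<open>x\<close>
  satisfies \<open>x \<bullet> v i \<le> h $ i\<close> for the support vector \<open>h\<close>, and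
  the sums over \<open>I\<close> agree, so each inequality is an equality; this fixes
  \<open>x\<close>, as the generators form a basis.\<close>

lemma exposed_face_full_cone:
  assumes Q: "Q \<in> deformation_cone v \<Delta>" and I: "I \<in> full_cones"
  shows "exposed_face Q (\<Sum>i\<in>I. v i) = {cone_vertex (support_vector v Q) I}"
proof -
  have poly: "polytope Q" "Q \<noteq> {}"
    using Q by (auto simp: deformation_cone_def)
  define u where "u = (\<Sum>i\<in>I. v i)"
  note I' = full_conesD[OF I]
  have u: "u \<in> pos_hull v I"
    using pos_hullI[of I "\<lambda>_. 1" v] by (simp add: u_def)
  have cu: "coord I u = (\<chi> i. if i \<in> I then 1 else 0)"
    using coord_sum[OF I' order_refl, of "\<lambda>_. 1"] by (simp add: u_def)
  have "x = cone_vertex (support_vector v Q) I" if x: "x \<in> exposed_face Q u" for x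
  proof (rule cone_vertex_eqI[OF I])
    have le: "x \<bullet> v i \<le> support_vector v Q $ i" for i
      using x support_fun_upper[OF poly(1)] by (simp add: support_vector_def exposed_face_def)
    have "x \<bullet> u = support_vector v Q \<bullet> fcoord u"
      using x support_fun_deformation[OF Q] by (simp add: exposed_face_def)
    then have "(\<Sum>i\<in>I. support_vector v Q $ i - x \<bullet> v i) = 0"
      by (simp add: inner_pos_hull_sum[OF I' u] inner_coord_sum[OF I' u] cu sum_subtractf)
    then have "\<forall>i\<in>I. support_vector v Q $ i - x \<bullet> v i = 0"
      by (subst (asm) sum_nonneg_eq_0_iff) (use le in auto)
    then show "x \<bullet> v i = support_vector v Q $ i" if "i \<in> I" for i
      using that by simp
  qed
  then show ?thesis
    using exposed_face(2)[OF poly] unfolding u_def by blast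
qed

text \<open>These inequalities say that all candidate vertices lie in
\<open>{x. \<forall>i. x \<bullet> v i \<le> h $ i}\<close>; equivalently, the extension of \<open>h\<close> that is linear on the cones
of the fan is convex.\<close>

definition support_cone :: "(real^'n) set" where
  "support_cone = {h. \<forall>I\<in>full_cones. \<forall>k. h \<bullet> coord I (v k) \<le> h $ k}"

lemma support_vector_in_support_cone:
  assumes Q: "Q \<in> deformation_cone v \<Delta>"
  shows "support_vector v Q \<in> support_cone"
  unfolding support_cone_def
proof (clarify)
  fix I k assume I: "I \<in> full_cones"
  have "cone_vertex (support_vector v Q) I \<in> Q"
    using exposed_face_full_cone[OF Q I] by (auto simp: exposed_face_def)
  then show "support_vector v Q \<bullet> coord I (v k) \<le> support_vector v Q $ k"
    using Q support_fun_upper[of Q "cone_vertex (support_vector v Q) I" "v k"]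
    by (simp add: inner_cone_vertex[OF full_conesD[OF I]] support_vector_def deformation_cone_def)
qed

text \<open>The support function of \<open>Q\<close> is the piecewise linear extension of
  \<open>h\<close>: it is an upper bound on \<open>Q\<close> by non-negativity of coordinates, and
  it is attained at the candidate vertices, which lie in \<open>Q\<close> by the inequalities on
  \<open>h\<close>.\<close>

lemma support_cone_polytope:
  assumes h: "h \<in> support_cone"
  defines "Q \<equiv> {x. \<forall>i. x \<bullet> v i \<le> h $ i}"
  shows "Q \<in> deformation_cone v \<Delta>" "support_vector v Q = h"
proof -
  have le: "x \<bullet> u \<le> h \<bullet> fcoord u" if "x \<in> Q" for x u
  proof -
    obtain I where I: "I \<in> \<Delta>" "u \<in> pos_hull v I"
      using fan_complete by blast
    then show ?thesis
      using that pos_hull_iff[of I u]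
      by (auto simp: inner_pos_hull_sum[OF I] inner_coord_sum[OF I] Q_def intro!: sum_mono mult_left_mono)
  qed
  have vert: "cone_vertex h I \<in> Q" if "I \<in> full_cones" for I
    using h that by (simp add: Q_def support_cone_def inner_cone_vertex[OF full_conesD])
  have supp: "support_fun Q u = h \<bullet> fcoord u" for u
  proof -
    obtain I where I: "I \<in> full_cones" "u \<in> pos_hull v I"
      using full_cones_cover by blast
    have "cone_vertex h I \<bullet> u = h \<bullet> fcoord u"
      using I by (simp add: inner_cone_vertex fcoord_eq[OF full_conesD] full_conesD)
    then show ?thesis
      using support_fun_eqI[OF vert[OF I(1)], of u] le by simp
  qed
  show "support_vector v Q = h"
    by (simp add: support_vector_def supp fcoord_generator inner_axis vec_eq_iff)
  have "Q \<noteq> {}"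
    using full_cones_cover vert by blast
  moreover have "polytope Q"
  proof -
    have "Q = \<Inter>(range (\<lambda>i. {x. v i \<bullet> x \<le> h $ i}))"
      by (auto simp: Q_def inner_commute)
    then have "polyhedron Q"
      by (auto intro!: polyhedron_Inter simp: polyhedron_halfspace_le)
    moreover have "bounded Q"
    proof (rule boundedI)
      fix x assume x: "x \<in> Q"
      \<comment> \<open>The support function in the directions of the positive and negative
        coordinate axes bounds \<open>Q\<close>.\<close>
      have "\<bar>x $ k\<bar> \<le> \<bar>h \<bullet> fcoord (axis k 1)\<bar> + \<bar>h \<bullet> fcoord (- axis k 1)\<bar>" for k
        using le[OF x, of "axis k 1"] le[OF x, of "- axis k 1"] by (simp add: inner_axis)
      then have "(\<Sum>k\<in>UNIV. \<bar>x $ k\<bar>) \<le>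
          (\<Sum>k\<in>UNIV. \<bar>h \<bullet> fcoord (axis k 1)\<bar> + \<bar>h \<bullet> fcoord (- axis k 1)\<bar>)"
        by (intro sum_mono)
      then show "norm x \<le> (\<Sum>k\<in>UNIV. \<bar>h \<bullet> fcoord (axis k 1)\<bar> + \<bar>h \<bullet> fcoord (- axis k 1)\<bar>)"
        using norm_le_l1_cart[of x] by linarith
    qed
    ultimately show ?thesis
      using polytope_eq_bounded_polyhedron by blast
  qed
  moreover have "C = \<Union>{pos_hull v I | I. I \<in> \<Delta> \<and> pos_hull v I \<subseteq> C}" if "C \<in> normal_fan Q" for C
  proof -
    obtain F where face: "F face_of Q" "F \<noteq> {}" and F: "C = normal_cone Q F"
      using \<open>C \<in> normal_fan Q\<close> unfolding normal_fan_def by blast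
    have "F \<subseteq> Q"
      using face(1) by (rule face_of_imp_subset)
    have "\<exists>K\<in>\<Delta>. u \<in> pos_hull v K \<and> pos_hull v K \<subseteq> C" if u: "u \<in> C" for u
    proof -
      obtain I where I: "I \<in> \<Delta>" "u \<in> pos_hull v I"
        using fan_complete by blast
      \<comment> \<open>The cone on \<open>K\<close> has \<open>u\<close> in its relative interior.
        Any \<open>x\<close> in \<open>F\<close> maximizes in direction \<open>u\<close>, which
        forces \<open>x \<bullet> v i = h $ i\<close> for all \<open>i\<close> in \<open>K\<close>;
        so \<open>x\<close> maximizes in every direction of this cone.\<close>
      define K where "K = {i. 0 < coord I u $ i}"
      note K = coord_support[OF I, folded K_def]
      have "u \<in> pos_hull v K"
        by (subst K(3), rule pos_hullI) (simp add: K_def)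
      moreover have "pos_hull v K \<subseteq> C"
      proof
        fix w assume w: "w \<in> pos_hull v K"
        have "y \<bullet> w \<le> x \<bullet> w" if x: "x \<in> F" and y: "y \<in> Q" for x y
        proof -
          have xQ: "x \<in> Q"
            using x \<open>F \<subseteq> Q\<close> by blast
          have "x \<bullet> u = support_fun Q u"
            using support_fun_eqI[OF xQ, of u] u x by (simp add: F normal_cone_def)
          then have "(\<Sum>i\<in>I. coord I u $ i * (h $ i - x \<bullet> v i)) = 0"
            by (simp add: supp inner_pos_hull_sum[OF I] inner_coord_sum[OF I] sum_subtractf right_diff_distrib)
          moreover have "0 \<le> coord I u $ i * (h $ i - x \<bullet> v i)" if "i \<in> I" for i
            using xQ I that pos_hull_iff[of I u] by (simp add: Q_def)
          ultimately have zero: "\<forall>i\<in>I. coord I u $ i * (h $ i - x \<bullet> v i) = 0"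
            by (subst (asm) sum_nonneg_eq_0_iff) auto
          have gen: "x \<bullet> v i = h $ i" if "i \<in> K" for i
            using zero K(2) that by (force simp: K_def)
          have "x \<bullet> w = h \<bullet> fcoord w"
            by (simp add: inner_pos_hull_sum[OF K(1) w] inner_coord_sum[OF K(1) w] gen)
          then show ?thesis
            using le[OF y] by simp
        qed
        then show "w \<in> C"
          by (simp add: F normal_cone_def)
      qed
      ultimately show ?thesis
        using K(1) by blast
    qed
    then show ?thesis
      by blast
  qed
  ultimately show "Q \<in> deformation_cone v \<Delta>"
    unfolding deformation_cone_def by blast
qed

lemma support_vectors_eq: "support_vector v ` deformation_cone v \<Delta> = support_cone"
proof
  show "support_vector v ` deformation_cone v \<Delta> \<subseteq> support_cone"
    using support_vector_in_support_cone by blast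
  show "support_cone \<subseteq> support_vector v ` deformation_cone v \<Delta>"
  proof
    fix h assume h: "h \<in> support_cone"
    define Q where "Q = {x. \<forall>i. x \<bullet> v i \<le> h $ i}"
    have "Q \<in> deformation_cone v \<Delta>" "support_vector v Q = h"
      using support_cone_polytope[OF h] by (simp_all add: Q_def)
    then show "h \<in> support_vector v ` deformation_cone v \<Delta>"
      by blast
  qed
qed

lemma closed_support_cone: "closed support_cone"
proof -
  have "support_cone = (\<Inter>I\<in>full_cones. \<Inter>k. {h. h \<bullet> coord I (v k) \<le> h $ k})"
    by (auto simp: support_cone_def)
  also have "closed \<dots>"
    by (intro closed_INT ballI closed_Collect_le continuous_intros)
  finally show ?thesis .
qed

lemma convex_support_cone: "convex support_cone"
  by (auto simp: support_cone_def convex_def inner_add_left intro!: add_mono mult_left_mono)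

text \<open>The polytope whose normal fan is the given fan has a support vector at which every
  non-trivial inequality is strict. Equality for \<open>I\<close> and \<open>k\<close> outside
  \<open>I\<close> would put \<open>v k\<close> and the generators of \<open>I\<close> into one
  simplicial cone, giving more independent vectors than the dimension allows.\<close>

lemma interior_support_cone: "interior support_cone \<noteq> {}"
proof -
  obtain P where P: "polytope P" "pos_hull v ` \<Delta> = normal_fan P"
    using polytopal unfolding polytopal_fan_def by blast
  then have "P \<noteq> {}"
    using cone_empty by (auto simp: normal_fan_def)
  note face = exposed_face[OF P(1) this]
  have "\<exists>I\<in>\<Delta>. C = pos_hull v I" if "C \<in> normal_fan P" for C
    using that P(2) by blast
  \<comment> \<open>Each normal cone is itself a cone of the fan, hence one member of the
    union.\<close>
  then have "C = \<Union>{pos_hull v I | I. I \<in> \<Delta> \<and> pos_hull v I \<subseteq> C}" if "C \<in> normal_fan P" for C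
    using that by blast
  then have def: "P \<in> deformation_cone v \<Delta>"
    unfolding deformation_cone_def using P(1) \<open>P \<noteq> {}\<close> by blast
  define h where "h = support_vector v P"
  \<comment> \<open>For \<open>k\<close> in \<open>I\<close> the inequality is an equality for every
    vector, so strictness is asked only outside \<open>I\<close>.\<close>
  define W where "W = (\<Inter>I\<in>full_cones. \<Inter>k\<in>- I. {h. h \<bullet> coord I (v k) < h $ k})"
  have "open W"
    unfolding W_def by (intro open_INT ballI open_Collect_less continuous_intros) auto
  moreover have "W \<subseteq> support_cone"
  proof
    fix g assume g: "g \<in> W"
    have "g \<bullet> coord I (v k) \<le> g $ k" if I: "I \<in> full_cones" for I k
    proof (cases "k \<in> I")
      case True
      then show ?thesis
        by (simp add: coord(2)[OF full_conesD[OF I]] inner_axis)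
    next
      case False
      then show ?thesis
        using g I by (force simp: W_def)
    qed
    then show "g \<in> support_cone"
      by (simp add: support_cone_def)
  qed
  moreover have "h \<in> W"
  proof -
    have "h \<bullet> coord I (v k) < h $ k" if I: "I \<in> full_cones" and k: "k \<notin> I" for I k
    proof (rule ccontr)
      assume "\<not> ?thesis"
      moreover have "h \<bullet> coord I (v k) \<le> h $ k"
        using support_vector_in_support_cone[OF def] I by (simp add: h_def support_cone_def)
      ultimately have eq: "h \<bullet> coord I (v k) = h $ k"
        by simp
      define C where "C = normal_cone P (exposed_face P (\<Sum>i\<in>I. v i))"
      have C_iff: "w \<in> C \<longleftrightarrow> h \<bullet> coord I w = support_fun P w" for w
        unfolding C_def face(3)
        by (simp add: exposed_face_full_cone[OF def I] inner_cone_vertex full_conesD[OF I] flip: h_def)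
      obtain J where J: "J \<in> \<Delta>" "C = pos_hull v J"
        using face(4) P(2) unfolding C_def by (metis imageE)
      \<comment> \<open>Otherwise the ray of \<open>v i\<close> would meet the cone on
        \<open>J\<close> only in 0, although \<open>v i\<close> is non-zero and lies in
        both.\<close>
      have gen: "i \<in> J" if "v i \<in> C" for i
      proof (rule ccontr)
        assume "i \<notin> J"
        then have "v i \<in> pos_hull v {}"
          using that J cone_Int[OF cone_ray[of i] J(1)] generator_in_pos_hull[of i "{i}" v] by auto
        then have "v i = 0"
          by (simp add: pos_hull_def)
        then show False
          using cone_independent[OF cone_ray[of i]] by (simp add: dependent_zero)
      qed
      have "v k \<in> C"
        using eq by (simp add: C_iff h_def support_vector_def)
      moreover have "v i \<in> C" if "i \<in> I" for i
        using that by (simp add: C_iff coord(2)[OF full_conesD[OF I]] inner_axis h_def support_vector_def)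
      ultimately have "insert k I \<in> \<Delta>"
        using gen cone_subset[OF J(1)] by blast
      then have "dim (v ` insert k I) = Suc CARD('d)"
        using dim_cone[of "insert k I"] k I by (simp add: full_cones_def del: image_insert)
      then show False
        using dim_subset_UNIV[of "v ` insert k I"] by simp
    qed
    then show ?thesis
      by (simp add: W_def)
  qed
  ultimately show ?thesis
    using interior_maximal by blast
qed

subsection \<open>Uniqueness of the estimator\<close>

text \<open>The matrix called A in the opening text.\<close>

definition design :: "real^'d^'m \<Rightarrow> real^'n^'m" where
  "design U = (\<chi> j. fcoord (U $ j))"

lemma ls_objective_eq:
  fixes U :: "real^'d^'m"
  assumes "P \<in> deformation_cone v \<Delta>"
  shows "ls_objective P U y = (1 / real CARD('m)) * (norm (design U *v support_vector v P - y))\<^sup>2"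
proof -
  have "(norm z)\<^sup>2 = (\<Sum>j\<in>UNIV. (z $ j)\<^sup>2)" for z :: "real^'m"
    by (simp add: norm_vec_def L2_set_def sum_nonneg)
  then show ?thesis
    by (simp add: ls_objective_def support_fun_deformation[OF assms] design_def
        matrix_vector_mul_component inner_commute)
qed

lemma ls_estimator_eq:
  fixes U :: "real^'d^'m"
  shows "ls_estimator v \<Delta> U y =
    {h \<in> support_cone. \<forall>g\<in>support_cone. norm (design U *v h - y) \<le> norm (design U *v g - y)}"
proof -
  have "ls_objective P U y \<le> ls_objective Q U y \<longleftrightarrow>
      norm (design U *v support_vector v P - y) \<le> norm (design U *v support_vector v Q - y)"
    if "P \<in> deformation_cone v \<Delta>" "Q \<in> deformation_cone v \<Delta>" for P Q
    by (simp add: ls_objective_eq that divide_le_cancel power_mono_iff)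
  then show ?thesis
    unfolding ls_estimator_def support_vectors_eq[symmetric] by auto
qed

text \<open>Moving an interior point of the cone along a kernel vector leaves the fitted values
  unchanged and so yields two minimizers. For an injective matrix the minimizer is the unique
  preimage of the closest point to \<open>y\<close> in the image of the cone.\<close>

lemma unique_ls_iff_inj:
  fixes U :: "real^'d^'m"
  shows "U \<in> unique_ls_set v \<Delta> \<longleftrightarrow> inj ((*v) (design U))"
proof
  assume unique: "U \<in> unique_ls_set v \<Delta>"
  show "inj ((*v) (design U))"
  proof (rule ccontr)
    assume "\<not> ?thesis"
    then obtain k where k: "k \<noteq> 0" "design U *v k = 0"
      using vec.inj_iff_eq_0[of "design U"] by auto
    obtain h e where e: "e > 0" "ball h e \<subseteq> support_cone"
      using interior_support_cone by (auto simp: mem_interior)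
    \<comment> \<open>The factor places \<open>g\<close> at distance \<open>e / 2\<close> from
      \<open>h\<close>, inside the ball. With \<open>y\<close> the common image of both, each has
      residual 0.\<close>
    define g where "g = h + (e / (2 * norm k)) *\<^sub>R k"
    have "dist h g = e / 2"
      using k(1) e(1) by (simp add: g_def dist_norm)
    then have gh: "g \<in> support_cone" "h \<in> support_cone"
      using e by auto
    have "design U *v g = design U *v h"
      using k(2) by (simp add: g_def matrix_vector_right_distrib matrix_vector_mult_scaleR)
    then have "{g, h} \<subseteq> ls_estimator v \<Delta> U (design U *v h)"
      using gh by (simp add: ls_estimator_eq)
    moreover have "card (ls_estimator v \<Delta> U (design U *v h)) = 1"
      using unique by (simp add: unique_ls_set_def)
    then obtain x where "ls_estimator v \<Delta> U (design U *v h) = {x}"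
      by (elim card_1_singletonE)
    ultimately have "g = h"
      by simp
    then show False
      using k(1) e(1) by (simp add: g_def)
  qed
next
  assume inj: "inj ((*v) (design U))"
  have lin: "linear ((*v) (design U))"
    by simp
  define T where "T = (*v) (design U) ` support_cone"
  \<comment> \<open>Injectivity already enters here: it keeps the linear image of the closed cone
    closed.\<close>
  have T: "closed T" "convex T" "T \<noteq> {}"
    unfolding T_def using closed_injective_linear_image[OF closed_support_cone lin inj]
      convex_linear_image[OF lin convex_support_cone] interior_support_cone by auto
  have "card (ls_estimator v \<Delta> U y) = 1" for y
  proof -
    obtain h where h: "h \<in> support_cone" "closest_point T y = design U *v h"
      using closest_point_in_set[OF T(1,3), of y] by (auto simp: T_def)
    have "norm (design U *v h - y) \<le> norm (design U *v g - y)" if "g \<in> support_cone" for g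
      using closest_point_exists(2)[OF T(1,3), of y] that h(2)
      by (auto simp: T_def dist_norm norm_minus_commute)
    then have "h \<in> ls_estimator v \<Delta> U y"
      using h(1) by (simp add: ls_estimator_eq)
    moreover have "g = h" if "g \<in> ls_estimator v \<Delta> U y" for g
    proof -
      have "design U *v g = design U *v h"
        using \<open>h \<in> ls_estimator v \<Delta> U y\<close> that
        by (intro any_closest_point_unique[OF T(2,1), of _ _ y])
          (auto simp: ls_estimator_eq T_def dist_norm norm_minus_commute)
      then show ?thesis
        using inj by (simp add: inj_eq)
    qed
    ultimately have "ls_estimator v \<Delta> U y = {h}"
      by blast
    then show ?thesis
      by simp
  qed
  then show "U \<in> unique_ls_set v \<Delta>"
    by (simp add: unique_ls_set_def)
qed

lemma unique_ls_iff_minor: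
  fixes U :: "real^'d^'m"
  shows "U \<in> unique_ls_set v \<Delta> \<longleftrightarrow> (\<exists>f :: 'n \<Rightarrow> 'm. det (\<chi> i. fcoord (U $ f i)) \<noteq> 0)"
  unfolding unique_ls_iff_inj inj_matrix_iff_minor by (simp add: design_def)

text \<open>A non-zero minor persists in a neighbourhood because \<open>fcoord\<close> is
  continuous; it remains to find one matrix with such a minor.\<close>

lemma interior_unique_ls_set:
  assumes "CARD('n) \<le> CARD('m::finite)"
  shows "interior (unique_ls_set v \<Delta> :: (real^'d^'m) set) \<noteq> {}"
proof -
  obtain f :: "'n \<Rightarrow> 'm" where f: "inj f"
    using card_le_inj[of "UNIV :: 'n set" "UNIV :: 'm set"] assms by auto
  define W :: "(real^'d^'m) set" where "W = {U. det (\<chi> i. fcoord (U $ f i)) \<noteq> 0}"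
  have "continuous_on UNIV (\<lambda>U :: real^'d^'m. det (\<chi> i. fcoord (U $ f i)))"
    by (intro continuous_on_det_real)
      (simp, intro continuous_intros continuous_on_compose2[OF continuous_on_fcoord], auto)
  then have "open W"
    unfolding W_def by (intro open_Collect_neq continuous_on_const)
  moreover have "W \<subseteq> unique_ls_set v \<Delta>"
    unfolding W_def unique_ls_iff_minor subset_iff by blast
  \<comment> \<open>Row \<open>f i\<close> is the generator \<open>v i\<close>, which makes the
    minor that of the identity matrix; rows outside \<open>range f\<close> do not enter it.\<close>
  moreover have "(\<chi> j. v (inv f j)) \<in> W"
  proof -
    have "(\<chi> i. fcoord (v (inv f (f i)))) = mat 1"
      using f by (simp add: fcoord_generator mat_def axis_def vec_eq_iff)
    then show ?thesis
      by (simp add: W_def)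
  qed
  ultimately show ?thesis
    using interior_maximal by blast
qed

section \<open>Generic designs and the minors given by matchings\<close>

text \<open>The minor singled out by a matching, if row \<open>j\<close> of \<open>U\<close> lies in the cone spanned by
\<open>S j\<close>; replacing each \<open>fcoord\<close> by the linear map \<open>coord (S j)\<close> makes it polynomial in \<open>U\<close>.\<close>

definition cone_minor :: "('m \<Rightarrow> 'n set) \<Rightarrow> ('n \<Rightarrow> 'm) \<Rightarrow> real^'d^'m \<Rightarrow> real" where
  "cone_minor S f U = det (\<chi> i. coord (S (f i)) (U $ f i))"

lemma null_sets_cone_minor:
  fixes f :: "'n \<Rightarrow> 'm::finite"
  assumes S: "range S \<subseteq> \<Delta>" and f: "inj f" "\<And>i. i \<in> S (f i)"
  shows "{U. cone_minor S f U = 0} \<in> null_sets lborel"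
proof (rule null_sets_zeros_polynomial_on_lines)
  have S': "S j \<in> \<Delta>" for j
    using S by blast
  show "continuous_on UNIV (cone_minor S f)"
    unfolding cone_minor_def
    by (intro continuous_on_det_real)
      (simp, intro continuous_intros continuous_on_compose2[OF continuous_on_coord[OF S']], auto)
  \<comment> \<open>The centre of the lines: since \<open>i \<in> S (f i)\<close>, the map
    \<open>coord (S (f i))\<close> sends row \<open>f i\<close>, which is \<open>v i\<close>, to the
    \<open>i\<close>-th unit vector, and the minor equals 1.\<close>
  define A :: "real^'d^'m" where "A = (\<chi> j. v (inv f j))"
  have "(\<chi> i. coord (S (f i)) (A $ f i)) = mat 1"
    using f by (simp add: A_def coord(2)[OF S'] mat_def axis_def vec_eq_iff)
  then show "cone_minor S f A \<noteq> 0"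
    by (simp add: cone_minor_def)
  show "\<exists>q. \<forall>t. cone_minor S f (A + t *\<^sub>R U) = poly q t" for U
  proof -
    have "(\<chi> i. coord (S (f i)) ((A + t *\<^sub>R U) $ f i)) =
        (\<chi> i. coord (S (f i)) (A $ f i)) + t *\<^sub>R (\<chi> i. coord (S (f i)) (U $ f i))" for t
      by (simp add: vec_eq_iff linear_add[OF coord(1)[OF S']] linear_scale[OF coord(1)[OF S']])
    then show ?thesis
      unfolding cone_minor_def using det_affine_polynomial by simp
  qed
qed

text \<open>Let \<open>S\<close> pick a cone containing each row of \<open>U\<close>; on these rows
  \<open>coord (S j)\<close> agrees with \<open>fcoord\<close>, so \<open>cone_minor S f U\<close>
  is a true minor of the design matrix. A positive coordinate \<open>i\<close> of row
  \<open>f i\<close> forces \<open>i \<in> S (f i)\<close>.\<close>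

lemma perfect_matching_imp_unique_ls:
  fixes U :: "real^'d^'m"
  assumes generic: "\<And>S f. range S \<subseteq> \<Delta> \<Longrightarrow> inj f \<Longrightarrow> (\<And>i. i \<in> S (f i)) \<Longrightarrow> cone_minor S f U \<noteq> 0"
    and "has_matching_of_size (GU_edges v \<Delta> U) CARD('n)"
  shows "U \<in> unique_ls_set v \<Delta>"
proof -
  obtain f :: "'n \<Rightarrow> 'm" where f: "inj f" "\<And>i. fan_coord v \<Delta> (U $ f i) i > 0"
    using assms(2) by (auto simp: perfect_matching_iff GU_edges_def)
  have "\<forall>j. \<exists>I. I \<in> \<Delta> \<and> U $ j \<in> pos_hull v I"
    using fan_complete by blast
  then obtain S where S: "\<And>j. S j \<in> \<Delta>" "\<And>j. U $ j \<in> pos_hull v (S j)"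
    by metis
  have "i \<in> S (f i)" for i
    using f(2)[of i] coord_outside[OF S(1) S(2), of i "f i"] by (auto simp: fan_coord_eq[OF S])
  then have "cone_minor S f U \<noteq> 0"
    using S(1) f(1) by (intro generic) auto
  then have "det (\<chi> i. fcoord (U $ f i)) \<noteq> 0"
    by (simp add: cone_minor_def fcoord_eq[OF S])
  then show ?thesis
    unfolding unique_ls_iff_minor by blast
qed

text \<open>A non-zero Leibniz term gives non-zero entries, which are edges because coordinates are
  non-negative. Equal rows would kill the determinant, so \<open>f\<close> is injective, and
  generator \<open>i\<close> is matched to row \<open>f (inv p i)\<close>.\<close>

lemma unique_ls_imp_perfect_matching:
  fixes U :: "real^'d^'m"
  assumes "U \<in> unique_ls_set v \<Delta>"
  shows "has_matching_of_size (GU_edges v \<Delta> U) CARD('n)"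
proof -
  obtain f :: "'n \<Rightarrow> 'm" where f: "det (\<chi> i. fcoord (U $ f i)) \<noteq> 0"
    using assms unfolding unique_ls_iff_minor by blast
  then obtain p where p: "p permutes UNIV" "\<And>i. fcoord (U $ f i) $ p i \<noteq> 0"
    by (elim det_nonzero_transversal) auto
  have "inj f"
  proof (rule injI, rule ccontr)
    fix i j assume "f i = f j" "i \<noteq> j"
    then have "det (\<chi> i. fcoord (U $ f i)) = 0"
      by (intro det_identical_rows[of i j]) (auto simp: row_def)
    then show False
      using f by simp
  qed
  have "inj (f \<circ> inv p)"
    using \<open>inj f\<close> permutes_inj[OF permutes_inv[OF p(1)]] by (rule inj_compose)
  moreover have "(i, (f \<circ> inv p) i) \<in> GU_edges v \<Delta> U" for i
    using p(2)[of "inv p i"] fan_coord_nonneg[of "U $ f (inv p i)" i]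
    by (simp add: GU_edges_def fcoord_def permutes_inverses[OF p(1)])
  ultimately show ?thesis
    unfolding perfect_matching_iff by blast
qed

end

theorem theorem3p7:
  fixes v :: "'n::finite \<Rightarrow> real^'d" and \<Delta> :: "'n set set"
  assumes "simplicial_fan v \<Delta>" and "polytopal_fan v \<Delta>"
  shows "(CARD('m::finite) \<ge> CARD('n) \<longrightarrow>
            interior (unique_ls_set v \<Delta> :: (real^'d^'m) set) \<noteq> {})
       \<and> (\<exists>N. N \<in> null_sets (lborel :: (real^'d^'m) measure) \<and>
            (\<forall>U. U \<notin> N \<longrightarrow>
               (U \<in> unique_ls_set v \<Delta> \<longleftrightarrow> has_matching_of_size (GU_edges v \<Delta> U) CARD('n))))"
proof -
  interpret simplicial_polytopal_fan v \<Delta>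
    using assms by unfold_locales
  \<comment> \<open>All choices of a cone for each row together with a compatible matching. There
    are finitely many, so \<open>N\<close> is a finite union of null sets that does not depend on
    \<open>U\<close>.\<close>
  define D :: "(('m \<Rightarrow> 'n set) \<times> ('n \<Rightarrow> 'm)) set"
    where "D = {(S, f). range S \<subseteq> \<Delta> \<and> inj f \<and> (\<forall>i. i \<in> S (f i))}"
  define N :: "(real^'d^'m) set" where "N = (\<Union>(S, f)\<in>D. {U. cone_minor S f U = 0})"
  have "N \<in> null_sets lborel"
    unfolding N_def
    by (rule null_sets_UN') (auto simp: D_def intro!: null_sets_cone_minor countable_finite)
  moreover have "U \<in> unique_ls_set v \<Delta> \<longleftrightarrow> has_matching_of_size (GU_edges v \<Delta> U) CARD('n)"
    if "U \<notin> N" for U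
  proof -
    have "cone_minor S f U \<noteq> 0" if "range S \<subseteq> \<Delta>" "inj f" "\<And>i. i \<in> S (f i)" for S f
    proof -
      have "(S, f) \<in> D"
        using that by (simp add: D_def)
      then show ?thesis
        using \<open>U \<notin> N\<close> by (auto simp: N_def)
    qed
    then show ?thesis
      using perfect_matching_imp_unique_ls unique_ls_imp_perfect_matching by blast
  qed
  ultimately show ?thesis
    using interior_unique_ls_set by blast
qed

end
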